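(* Let $\nu>0$, $K_{\min}\ge 0$, let $\chi_\omega\in L^\infty(\mathbb{T}^3)$ be nonnegative, and let $\varphi_1,\dots,\varphi_N\in V$ be orthonormal in $H$. Let $S,M_\omega\in\mathbb{R}^{N\times N}$ be given by $$S_{ij}:=\nu\langle\nabla\varphi_i,\nabla\varphi_j\rangle_{L^2},\qquad(M_\omega)_{ij}:=\langle\chi_\omega\varphi_i,\varphi_j\rangle_{L^2}.$$ Then there exists a constant $\alpha_{\omega,N}\ge 0$ such that $$z^\top(S+K_{\min}M_\omega)z\ge\alpha_{\omega,N}\|z\|^2,\qquad\forall z\in\mathbb{R}^N,$$ and the largest such constant is $\alpha_{\omega,N}=\lambda_{\min}(S+K_{\min}M_\omega)$.
   Context: $\mathbb{T}^3=(\mathbb{R}/\mathbb{Z})^3$. $H:=\{v\in L^2(\mathbb{T}^3;\mathbb{R}^3): \nabla\cdot v=0,\ \int_{\mathbb{T}^3}v\,dx=0\}$ with the $L^2$ inner product, and $V:=H^1(\mathbb{T}^3;\mathbb{R}^3)\cap H$. $\lambda_{\min}$ denotes the smallest eigenvalue of a real symmetric matrix and $\|z\|$ the Euclidean norm. *)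

theory Defs
  imports "HOL-Analysis.Analysis"
begin

text \<open>Functions on the torus (R/Z)^3 are represented by their pullbacks to R^3, i.e. by
  Z^3-periodic functions, and integrated over the fundamental cell (whose faces are null sets).
  Elements of L^p spaces are represented by measurable functions; no choice of representative
  matters below.\<close>

definition periodic :: "(real^3 \<Rightarrow> 'a) \<Rightarrow> bool" where
  "periodic f \<longleftrightarrow> (\<forall>x i. f (x + axis i 1) = f x)"

definition cell :: "(real^3) measure" where
  "cell = lebesgue_on (cbox 0 1)"

definition L2 :: "(real^3 \<Rightarrow> 'a::euclidean_space) set" where
  "L2 = {f. periodic f \<and> f \<in> borel_measurable lebesgue \<and> integrable cell (\<lambda>x. (norm (f x))\<^sup>2)}"

definition Linf :: "(real^3 \<Rightarrow> real) set" where
  "Linf = {f. periodic f \<and> f \<in> borel_measurable lebesgue \<and> (\<exists>C. AE x in cell. \<bar>f x\<bar> \<le> C)}"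

text \<open>On matrix-valued functions the inner product of type \<^typ>\<open>real^3^3\<close> is the
  entrywise (Frobenius) one.\<close>

definition L2_inner :: "(real^3 \<Rightarrow> 'a::euclidean_space) \<Rightarrow> (real^3 \<Rightarrow> 'a) \<Rightarrow> real" where
  "L2_inner f g = (LINT x|cell. f x \<bullet> g x)"

definition partial :: "3 \<Rightarrow> (real^3 \<Rightarrow> real) \<Rightarrow> real^3 \<Rightarrow> real" where
  "partial j f x = frechet_derivative f (at x) (axis j 1)"

primrec Ck :: "nat \<Rightarrow> (real^3 \<Rightarrow> real) \<Rightarrow> bool" where
  "Ck 0 f \<longleftrightarrow> continuous_on UNIV f"
| "Ck (Suc k) f \<longleftrightarrow> (\<forall>x. f differentiable (at x)) \<and> (\<forall>j. Ck k (partial j f))"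

definition test_function :: "(real^3 \<Rightarrow> real) \<Rightarrow> bool" where
  "test_function \<psi> \<longleftrightarrow> periodic \<psi> \<and> (\<forall>k. Ck k \<psi>)"

definition weak_div_free :: "(real^3 \<Rightarrow> real^3) \<Rightarrow> bool" where
  "weak_div_free v \<longleftrightarrow>
    (\<forall>\<psi>. test_function \<psi> \<longrightarrow> (LINT x|cell. v x \<bullet> (\<chi> j. partial j \<psi> x)) = 0)"

text \<open>The entry \<open>G x $ k $ j\<close> is the \<open>j\<close>-th weak partial derivative of the \<open>k\<close>-th component.\<close>

definition is_weak_grad :: "(real^3 \<Rightarrow> real^3) \<Rightarrow> (real^3 \<Rightarrow> real^3^3) \<Rightarrow> bool" where
  "is_weak_grad v G \<longleftrightarrow> G \<in> L2 \<and>
    (\<forall>\<psi> k j. test_function \<psi> \<longrightarrow>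
       (LINT x|cell. v x $ k * partial j \<psi> x) = - (LINT x|cell. G x $ k $ j * \<psi> x))"

definition H1 :: "(real^3 \<Rightarrow> real^3) set" where
  "H1 = {v \<in> L2. \<exists>G. is_weak_grad v G}"

text \<open>Weak gradients are unique up to null sets, so the choice only picks a representative.\<close>

definition weak_grad :: "(real^3 \<Rightarrow> real^3) \<Rightarrow> real^3 \<Rightarrow> real^3^3" where
  "weak_grad v = (SOME G. is_weak_grad v G)"

definition H_space :: "(real^3 \<Rightarrow> real^3) set" where
  "H_space = {v \<in> L2. weak_div_free v \<and> (LINT x|cell. v x) = 0}"

definition V_space :: "(real^3 \<Rightarrow> real^3) set" where
  "V_space = H1 \<inter> H_space"

definition S_mat :: "real \<Rightarrow> ('n::finite \<Rightarrow> real^3 \<Rightarrow> real^3) \<Rightarrow> real^'n^'n" where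
  "S_mat \<nu> \<phi> = (\<chi> i j. \<nu> * L2_inner (weak_grad (\<phi> i)) (weak_grad (\<phi> j)))"

definition M_mat :: "(real^3 \<Rightarrow> real) \<Rightarrow> ('n::finite \<Rightarrow> real^3 \<Rightarrow> real^3) \<Rightarrow> real^'n^'n" where
  "M_mat \<chi>\<^sub>\<omega> \<phi> = (\<chi> i j. L2_inner (\<lambda>x. \<chi>\<^sub>\<omega> x *\<^sub>R \<phi> i x) (\<phi> j))"

definition eigenvalue :: "real^'n^'n \<Rightarrow> real \<Rightarrow> bool" where
  "eigenvalue A l \<longleftrightarrow> (\<exists>v. v \<noteq> 0 \<and> A *v v = l *\<^sub>R v)"

text \<open>Meaningful for symmetric matrices, which have a nonempty finite set of real eigenvalues.\<close>

definition lambda_min :: "real^'n^'n \<Rightarrow> real" where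
  "lambda_min A = (LEAST l. eigenvalue A l)"

end

theory Submission
  imports Defs
begin

text \<open>For a coefficient vector \<open>z\<close> the quadratic forms of \<open>S\<close> and \<open>M\<close> are
  \<open>\<nu> \<parallel>\<Sum>\<^sub>i z\<^sub>i \<nabla>\<phi>\<^sub>i\<parallel>\<^sup>2\<close> and the integral of \<open>\<chi>\<^sub>\<omega> |\<Sum>\<^sub>i z\<^sub>i \<phi>\<^sub>i|\<^sup>2\<close>, so \<open>A = S + K\<^sub>m\<^sub>i\<^sub>n M\<close> is symmetric and
  positive semidefinite. By compactness the Rayleigh quotient of \<open>A\<close> attains its minimum \<open>m\<close> at a
  unit vector \<open>u\<close>. The form of \<open>A - m I\<close> is nonnegative and vanishes at \<open>u\<close>, hence so does its
  gradient there, i.e. \<open>A u = m u\<close>; thus \<open>m = \<lambda>\<^sub>m\<^sub>i\<^sub>n A\<close>, and \<open>u\<close> shows that \<open>m\<close> is optimal.\<close>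

text \<open>Moving from \<open>u\<close> along \<open>w = B *v u\<close>, the form has linear term
  \<open>2 * t * (w \<bullet> w)\<close> and no constant term. If \<open>w\<close> were nonzero, a
  small negative \<open>t\<close> would make the form negative.\<close>

lemma nonneg_form_kernel:
  fixes B :: "real^'n^'n"
  assumes sym: "transpose B = B" and nonneg: "\<And>z. 0 \<le> z \<bullet> (B *v z)" and null: "u \<bullet> (B *v u) = 0"
  shows "B *v u = 0"
proof (rule ccontr)
  define w where "w = B *v u"
  define a where "a = w \<bullet> w"
  define c where "c = w \<bullet> (B *v w)"
  assume "B *v u \<noteq> 0"
  then have "a > 0"
    by (simp add: a_def w_def)
  have c: "c \<ge> 0"
    using nonneg by (simp add: c_def)
  have uw: "u \<bullet> (B *v w) = a"
    using sym by (metis a_def w_def dot_lmul_matrix transpose_matrix_vector)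
  have form: "0 \<le> 2 * t * a + t\<^sup>2 * c" for t
  proof -
    have "B *v (u + t *\<^sub>R w) = w + t *\<^sub>R (B *v w)"
      by (simp add: matrix_vector_right_distrib matrix_vector_mult_scaleR w_def)
    moreover have "u \<bullet> w = 0"
      using null by (simp add: w_def)
    ultimately have "(u + t *\<^sub>R w) \<bullet> (B *v (u + t *\<^sub>R w)) = 2 * t * a + t\<^sup>2 * c"
      by (simp add: inner_add_left inner_add_right uw power2_eq_square algebra_simps
            flip: a_def c_def)
    then show ?thesis
      using nonneg by metis
  qed
  \<comment> \<open>The minimiser of the quadratic would be \<open>- a / c\<close>; the added 1
    keeps the denominator positive when \<open>c = 0\<close> and still gives a negative
    value.\<close>
  define t where "t = - a / (c + 1)"
  have "t < 0" and tc: "t * c = - a - t"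
    using \<open>a > 0\<close> c by (simp_all add: t_def field_simps)
  have "2 * t * a + t\<^sup>2 * c = t * (2 * a + t * c)"
    by (simp add: power2_eq_square algebra_simps)
  also have "\<dots> = t * (a - t)"
    by (simp add: tc)
  also have "\<dots> < 0"
    using \<open>t < 0\<close> \<open>a > 0\<close> by (simp add: mult_neg_pos)
  finally show False
    using form[of t] by simp
qed

lemma rayleigh_minimum:
  fixes A :: "real^'n^'n"
  obtains u where "norm u = 1" and "\<And>z. (u \<bullet> (A *v u)) * (norm z)\<^sup>2 \<le> z \<bullet> (A *v z)"
proof -
  have "continuous_on (sphere 0 1) (\<lambda>z. z \<bullet> (A *v z))"
    by (intro continuous_intros)
  moreover have "sphere (0::real^'n) 1 \<noteq> {}"
    by simp
  ultimately have "\<exists>u\<in>sphere 0 1. \<forall>z\<in>sphere 0 1. u \<bullet> (A *v u) \<le> z \<bullet> (A *v z)"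
    by (intro continuous_attains_inf compact_sphere)
  then obtain u where u: "u \<in> sphere 0 1"
    and min: "\<And>z. z \<in> sphere 0 1 \<Longrightarrow> u \<bullet> (A *v u) \<le> z \<bullet> (A *v z)"
    by blast
  have "(u \<bullet> (A *v u)) * (norm z)\<^sup>2 \<le> z \<bullet> (A *v z)" for z
  \<comment> \<open>Both sides are homogeneous of degree 2, so a nonzero \<open>z\<close> can be
    rescaled to the sphere.\<close>
  proof (cases "z = 0")
    case False
    then have "u \<bullet> (A *v u) \<le> (z /\<^sub>R norm z) \<bullet> (A *v (z /\<^sub>R norm z))"
      by (intro min) simp
    also have "\<dots> = z \<bullet> (A *v z) / (norm z)\<^sup>2"
      by (simp add: matrix_vector_mult_scaleR power2_eq_square divide_inverse)
    finally show ?thesis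
      using False by (simp add: field_simps)
  qed simp
  with u show thesis
    by (intro that) auto
qed

lemma lambda_min_rayleigh:
  fixes A :: "real^'n^'n"
  assumes "transpose A = A"
  obtains u where "norm u = 1" and "u \<bullet> (A *v u) = lambda_min A"
    and "\<And>z. lambda_min A * (norm z)\<^sup>2 \<le> z \<bullet> (A *v z)"
proof -
  obtain u where u: "norm u = 1" and min: "\<And>z. (u \<bullet> (A *v u)) * (norm z)\<^sup>2 \<le> z \<bullet> (A *v z)"
    using rayleigh_minimum[of A] by blast
  define m where "m = u \<bullet> (A *v u)"
  define B where "B = A - m *\<^sub>R mat 1"
  have B: "B *v z = A *v z - m *\<^sub>R z" for z
    by (simp add: B_def matrix_vector_mult_diff_rdistrib flip: scaleR_matrix_vector_assoc)
  have "transpose B = B"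
    using assms by (simp add: B_def transpose_def vec_eq_iff mat_def)
  then have "B *v u = 0"
    using min u by (intro nonneg_form_kernel)
      (auto simp: B inner_diff_right m_def norm_eq_1 simp flip: power2_norm_eq_inner)
  then have "eigenvalue A m"
    using u unfolding eigenvalue_def by (intro exI[of _ u]) (auto simp: B)
  \<comment> \<open>Every eigenvalue is the Rayleigh quotient at its eigenvector. As
    \<open>m\<close> is itself an eigenvalue, the \<open>LEAST\<close> over the reals is
    attained.\<close>
  moreover have "m \<le> l" if "eigenvalue A l" for l
  proof -
    from that obtain v where v: "v \<noteq> 0" "A *v v = l *\<^sub>R v"
      unfolding eigenvalue_def by blast
    then show ?thesis
      using min[of v] by (simp add: m_def power2_norm_eq_inner)
  qed
  ultimately have "lambda_min A = m"
    unfolding lambda_min_def by (rule Least_equality)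
  then show thesis
    using that u min by (simp add: m_def)
qed

text \<open>The form is the integral of \<open>w\<close> times the squared norm of the combination
  of the \<open>f i\<close> with coefficients \<open>z\<close>. Weight 1 with the weak gradients
  covers \<open>S\<close>; the weight \<open>\<chi>\<^sub>\<omega>\<close> with
  \<open>\<phi>\<close> covers \<open>M\<close>.\<close>

lemma weighted_gram_nonneg:
  fixes f :: "'n::finite \<Rightarrow> 'b \<Rightarrow> 'a::real_inner"
  assumes int: "\<And>i j. integrable M (\<lambda>x. w x * (f i x \<bullet> f j x))" and w: "AE x in M. 0 \<le> w x"
  shows "0 \<le> z \<bullet> ((\<chi> i j. LINT x|M. w x * (f i x \<bullet> f j x)) *v z)"
proof -
  have "z \<bullet> ((\<chi> i j. LINT x|M. w x * (f i x \<bullet> f j x)) *v z) =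
      (\<Sum>i\<in>UNIV. \<Sum>j\<in>UNIV. z $ i * z $ j * (LINT x|M. w x * (f i x \<bullet> f j x)))"
    by (simp add: inner_vec_def matrix_vector_mult_def sum_distrib_left mult_ac)
  also have "\<dots> = (LINT x|M. (\<Sum>i\<in>UNIV. \<Sum>j\<in>UNIV. z $ i * z $ j * (w x * (f i x \<bullet> f j x))))"
    by (simp add: int)
  also have "\<dots> = (LINT x|M. w x * (norm (\<Sum>i\<in>UNIV. z $ i *\<^sub>R f i x))\<^sup>2)"
    by (simp add: power2_norm_eq_inner inner_sum_left inner_sum_right sum_distrib_left mult_ac
        inner_commute)
  also have "\<dots> \<ge> 0"
    using w by (intro integral_nonneg_AE) auto
  finally show ?thesis .
qed

text \<open>Cauchy-Schwarz and the bound of a product by a sum of squares give the integrable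
  majorant \<open>C * ((norm (f x))\<^sup>2 + (norm (g x))\<^sup>2)\<close>.\<close>

lemma integrable_weighted_L2_inner:
  fixes f g :: "real^3 \<Rightarrow> 'a::euclidean_space"
  assumes w: "w \<in> Linf" and f: "f \<in> L2" and g: "g \<in> L2"
  shows "integrable cell (\<lambda>x. w x * (f x \<bullet> g x))"
proof -
  have meas: "h \<in> borel_measurable cell" if "h \<in> borel_measurable lebesgue"
    for h :: "real^3 \<Rightarrow> 'c::euclidean_space"
    using that unfolding cell_def by (rule measurable_restrict_space1)
  have [measurable]: "w \<in> borel_measurable cell" "f \<in> borel_measurable cell"
      "g \<in> borel_measurable cell"
    using assms by (auto simp: Linf_def L2_def intro: meas)
  obtain C where C: "AE x in cell. \<bar>w x\<bar> \<le> C"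
    using w by (auto simp: Linf_def)
  show ?thesis
  proof (rule Bochner_Integration.integrable_bound)
    show "integrable cell (\<lambda>x. C * ((norm (f x))\<^sup>2 + (norm (g x))\<^sup>2))"
      using f g by (simp add: L2_def)
    show "AE x in cell. norm (w x * (f x \<bullet> g x)) \<le> norm (C * ((norm (f x))\<^sup>2 + (norm (g x))\<^sup>2))"
      using C
    proof eventually_elim
      case (elim x)
      have "\<bar>f x \<bullet> g x\<bar> \<le> norm (f x) * norm (g x)"
        by (rule Cauchy_Schwarz_ineq2)
      also have "\<dots> \<le> (norm (f x))\<^sup>2 + (norm (g x))\<^sup>2"
        using sum_squares_bound[of "norm (f x)" "norm (g x)"]
          mult_nonneg_nonneg[OF norm_ge_zero[of "f x"] norm_ge_zero[of "g x"]] by linarith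
      finally show ?case
        using elim by (auto simp: abs_mult intro!: mult_mono)
    qed
  qed measurable
qed

lemma weak_grad_in_L2: "v \<in> H1 \<Longrightarrow> weak_grad v \<in> L2"
  unfolding H1_def weak_grad_def using someI_ex[of "is_weak_grad v"]
  by (simp add: is_weak_grad_def[of v "Eps _"])

theorem proposition5p2:
  fixes \<nu> K_min :: real
    and \<chi>\<^sub>\<omega> :: "real^3 \<Rightarrow> real"
    and \<phi> :: "'n::finite \<Rightarrow> real^3 \<Rightarrow> real^3"
    and S M :: "real^'n^'n"
  assumes "\<nu> > 0" and "K_min \<ge> 0"
    and "\<chi>\<^sub>\<omega> \<in> Linf" and "AE x in cell. 0 \<le> \<chi>\<^sub>\<omega> x"
    and "\<And>i. \<phi> i \<in> V_space"
    and "\<And>i j. L2_inner (\<phi> i) (\<phi> j) = (if i = j then 1 else 0)"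
    and "S = S_mat \<nu> \<phi>" and "M = M_mat \<chi>\<^sub>\<omega> \<phi>"
  defines "lower_bound \<equiv> \<lambda>\<alpha>::real. \<alpha> \<ge> 0 \<and>
    (\<forall>z::real^'n. z \<bullet> ((S + K_min *\<^sub>R M) *v z) \<ge> \<alpha> * (norm z)\<^sup>2)"
  shows "(\<exists>\<alpha>. lower_bound \<alpha>) \<and>
    lower_bound (lambda_min (S + K_min *\<^sub>R M)) \<and>
    (\<forall>\<alpha>. lower_bound \<alpha> \<longrightarrow> \<alpha> \<le> lambda_min (S + K_min *\<^sub>R M))"
proof -
  let ?A = "S + K_min *\<^sub>R M"
  have \<phi>: "\<phi> i \<in> L2" "weak_grad (\<phi> i) \<in> L2" for i
    using assms(5)[of i] weak_grad_in_L2 by (auto simp: V_space_def H_space_def)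
  have one: "(\<lambda>x. 1) \<in> Linf"
    by (auto simp: Linf_def periodic_def)
  have S: "S = \<nu> *\<^sub>R (\<chi> i j. LINT x|cell. 1 * (weak_grad (\<phi> i) x \<bullet> weak_grad (\<phi> j) x))"
    by (simp add: \<open>S = _\<close> S_mat_def L2_inner_def vec_eq_iff)
  have M: "M = (\<chi> i j. LINT x|cell. \<chi>\<^sub>\<omega> x * (\<phi> i x \<bullet> \<phi> j x))"
    by (simp add: \<open>M = _\<close> M_mat_def L2_inner_def)
  have "0 \<le> z \<bullet> (S *v z)" for z
    unfolding S scaleR_matrix_vector_assoc[symmetric] inner_scaleR_right
    using \<open>\<nu> > 0\<close> integrable_weighted_L2_inner[OF one \<phi>(2) \<phi>(2)]
    by (intro mult_nonneg_nonneg weighted_gram_nonneg) auto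
  moreover have "0 \<le> z \<bullet> (M *v z)" for z
    unfolding M using integrable_weighted_L2_inner[OF \<open>\<chi>\<^sub>\<omega> \<in> Linf\<close> \<phi>(1) \<phi>(1)] assms(4)
    by (rule weighted_gram_nonneg)
  ultimately have nonneg: "0 \<le> z \<bullet> (?A *v z)" for z
    using \<open>K_min \<ge> 0\<close>
    by (simp add: matrix_vector_mult_add_rdistrib inner_add_right flip: scaleR_matrix_vector_assoc)
  have "transpose ?A = ?A"
    by (simp add: S M transpose_def vec_eq_iff inner_commute)
  then obtain u where u: "norm u = 1" "u \<bullet> (?A *v u) = lambda_min ?A"
    and min: "\<And>z. lambda_min ?A * (norm z)\<^sup>2 \<le> z \<bullet> (?A *v z)"
    using lambda_min_rayleigh by blast
  \<comment> \<open>Nonnegativity holds because \<open>lambda_min ?A\<close> is the value of a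
    nonnegative form at \<open>u\<close>.\<close>
  have "lower_bound (lambda_min ?A)"
    using nonneg[of u] u min by (simp add: lower_bound_def)
  \<comment> \<open>Test the bound at the unit vector \<open>u\<close>.\<close>
  moreover have "\<alpha> \<le> lambda_min ?A" if "lower_bound \<alpha>" for \<alpha>
    using that u unfolding lower_bound_def by (metis mult.right_neutral one_power2)
  ultimately show ?thesis
    by blast
qed

end
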